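(* Let $\mathrm{HCC}=\{\beta,\lambda,\rho,\epsilon,\tau\}$ be the set of the following five concepts of crossing, each regarded as a relation on ordered pairs $(D,L)$ of nonempty compact convex subsets of $\mathbb{R}^2$: \begin{itemize} \item $\tau$: $D$ and $L$ are Fejes-Tóth-crossing; \item $\epsilon$: $D$ and $L$ weakly line-cross each other; \item $\lambda$: $D$ line-crosses $L$; \item $\rho$: $L$ line-crosses $D$; \item $\beta$: $D$ and $L$ strongly line-cross each other. \end{itemize} For $u,v\in\mathrm{HCC}$ let $u\le v$ mean that for all nonempty compact convex $D,L\subseteq\mathbb{R}^2$, if $(D,L)$ satisfies $u$ then $(D,L)$ satisfies $v$. Let $u\le_{\mathrm{rot}} v$ mean that for all nonempty compact convex $D,L\subseteq\mathbb{R}^2$ such that $L$ is obtained from $D$ by a rotation of the plane, if $(D,L)$ satisfies $u$ then $(D,L)$ satisfies $v$. Then both $(\mathrm{HCC};\le)$ and $(\mathrm{HCC};\le_{\mathrm{rot}})$ are partially ordered sets on these five pairwise distinct elements, they are the same partially ordered set, and the covering relations (edges of the common Hasse diagram) are exactly $\beta\prec\lambda$, $\beta\prec\rho$, $\lambda\prec\epsilon$, $\rho\prec\epsilon$, $\epsilon\prec\tau$. (In particular, $\lambda$ and $\rho$ are incomparable.)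
   Context: All convex sets are assumed nonempty. A subset of $\mathbb{R}^2$ is connected if it is path-connected; the empty set counts as connected. Fejes-Tóth-crossing: convex sets $X,Y\subseteq\mathbb{R}^2$ are Fejes-Tóth-crossing if neither $X\setminus Y$ nor $Y\setminus X$ is connected. Supporting lines: all lines are directed (each has a direction on the unit circle; two directed lines with the same underlying point set but opposite directions are distinct). A directed line $\ell$ is a supporting line of a compact convex set $X\subseteq\mathbb{R}^2$ if $\ell\cap X\ne\emptyset$ and $X$ lies in the closed left half-plane determined by $\ell$. A common supporting line of $D$ and $L$ is a directed line that is a supporting line of both. For such a line $t$, the compact set $(D\cup L)\cap t$ has a unique first point and a unique last point with respect to the direction of $t$. Line-crossing: for compact convex $D,L\subseteq\mathbb{R}^2$, $D$ line-crosses $L$ if $D$ and $L$ have two distinct common supporting lines $t$ and $t'$ such that the first point of $(D\cup L)\cap t$ is in $D\setminus L$, the last point of $(D\cup L)\cap t$ is in $L\setminus D$, the first point of $(D\cup L)\cap t'$ is in $D\setminus L$, and the last point of $(D\cup L)\cap t'$ is in $L\setminus D$ (first and last with respect to the direction of the line in question). $D$ and $L$ strongly line-cross each other if $D$ line-crosses $L$ and $L$ line-crosses $D$; they weakly line-cross each other if $D$ line-crosses $L$ or $L$ line-crosses $D$. *)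

theory Defs
  imports "HOL-Analysis.Analysis"
begin

type_synonym point = "real^2"

definition compact_convex :: "point set \<Rightarrow> bool" where
  "compact_convex X \<longleftrightarrow> X \<noteq> {} \<and> compact X \<and> convex X"

text \<open>Note that \<^term>\<open>path_connected {}\<close> holds, so the empty set counts as connected.\<close>

definition fejes_toth_crossing :: "point set \<Rightarrow> point set \<Rightarrow> bool" where
  "fejes_toth_crossing X Y \<longleftrightarrow> \<not> path_connected (X - Y) \<and> \<not> path_connected (Y - X)"

text \<open>A directed line is its underlying point set together with a unit direction vector, so that
  equality of pairs is equality of directed lines; in particular the two orientations of a line
  are distinct.\<close>

type_synonym dline = "point set \<times> point"

definition directed_line :: "dline \<Rightarrow> bool" where
  "directed_line l \<longleftrightarrow> norm (snd l) = 1 \<and> (\<exists>p. fst l = {p + s *\<^sub>R snd l | s. True})"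

text \<open>The point q is on or to the left of the line through p with direction d iff
  det(d, q - p) is nonnegative; the choice of p on the line does not matter.\<close>

definition left_half_plane :: "dline \<Rightarrow> point set" where
  "left_half_plane l =
     {q. \<forall>p\<in>fst l. 0 \<le> snd l $ 1 * (q - p) $ 2 - snd l $ 2 * (q - p) $ 1}"

definition supporting_line :: "dline \<Rightarrow> point set \<Rightarrow> bool" where
  "supporting_line l X \<longleftrightarrow> directed_line l \<and> fst l \<inter> X \<noteq> {} \<and> X \<subseteq> left_half_plane l"

text \<open>First and last points are taken of a set K contained in the line l; they are
  unique then, and they exist if K is nonempty and compact.\<close>

definition is_first_point :: "dline \<Rightarrow> point set \<Rightarrow> point \<Rightarrow> bool" where
  "is_first_point l K p \<longleftrightarrow> p \<in> K \<and> (\<forall>q\<in>K. p \<bullet> snd l \<le> q \<bullet> snd l)"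

definition is_last_point :: "dline \<Rightarrow> point set \<Rightarrow> point \<Rightarrow> bool" where
  "is_last_point l K p \<longleftrightarrow> p \<in> K \<and> (\<forall>q\<in>K. q \<bullet> snd l \<le> p \<bullet> snd l)"

definition crossing_line :: "point set \<Rightarrow> point set \<Rightarrow> dline \<Rightarrow> bool" where
  "crossing_line D L t \<longleftrightarrow> supporting_line t D \<and> supporting_line t L \<and>
     (\<exists>p. is_first_point t ((D \<union> L) \<inter> fst t) p \<and> p \<in> D - L) \<and>
     (\<exists>q. is_last_point t ((D \<union> L) \<inter> fst t) q \<and> q \<in> L - D)"

definition line_crosses :: "point set \<Rightarrow> point set \<Rightarrow> bool" where
  "line_crosses D L \<longleftrightarrow> (\<exists>t t'. t \<noteq> t' \<and> crossing_line D L t \<and> crossing_line D L t')"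

definition strongly_line_cross :: "point set \<Rightarrow> point set \<Rightarrow> bool" where
  "strongly_line_cross D L \<longleftrightarrow> line_crosses D L \<and> line_crosses L D"

definition weakly_line_cross :: "point set \<Rightarrow> point set \<Rightarrow> bool" where
  "weakly_line_cross D L \<longleftrightarrow> line_crosses D L \<or> line_crosses L D"

text \<open>The five concepts, as sets of pairs of nonempty compact convex sets.\<close>

type_synonym concept = "(point set \<times> point set) set"

definition concept_of :: "(point set \<Rightarrow> point set \<Rightarrow> bool) \<Rightarrow> concept" where
  "concept_of P = {(D, L). compact_convex D \<and> compact_convex L \<and> P D L}"

definition cc_tau :: concept where
  "cc_tau = concept_of fejes_toth_crossing"

definition cc_epsilon :: concept where
  "cc_epsilon = concept_of weakly_line_cross"

definition cc_lambda :: concept where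
  "cc_lambda = concept_of line_crosses"

definition cc_rho :: concept where
  "cc_rho = concept_of (\<lambda>D L. line_crosses L D)"

definition cc_beta :: concept where
  "cc_beta = concept_of strongly_line_cross"

definition HCC :: "concept set" where
  "HCC = {cc_beta, cc_lambda, cc_rho, cc_epsilon, cc_tau}"

text \<open>Rotations about an arbitrary centre c; the rotation angle may be zero.\<close>

definition plane_rotation :: "(point \<Rightarrow> point) \<Rightarrow> bool" where
  "plane_rotation f \<longleftrightarrow>
     (\<exists>(A :: real^2^2) c. rotation_matrix A \<and> f = (\<lambda>x. c + A *v (x - c)))"

definition HCC_le :: "concept rel" where
  "HCC_le = {(u, v). u \<in> HCC \<and> v \<in> HCC \<and>
     (\<forall>D L. compact_convex D \<and> compact_convex L \<longrightarrow> (D, L) \<in> u \<longrightarrow> (D, L) \<in> v)}"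

definition HCC_le_rot :: "concept rel" where
  "HCC_le_rot = {(u, v). u \<in> HCC \<and> v \<in> HCC \<and>
     (\<forall>D L. compact_convex D \<and> compact_convex L \<and> (\<exists>f. plane_rotation f \<and> L = f ` D) \<longrightarrow>
        (D, L) \<in> u \<longrightarrow> (D, L) \<in> v)}"

definition covering :: "'a rel \<Rightarrow> 'a rel" where
  "covering r = {(u, v). (u, v) \<in> r \<and> u \<noteq> v \<and>
     \<not> (\<exists>w. w \<noteq> u \<and> w \<noteq> v \<and> (u, w) \<in> r \<and> (w, v) \<in> r)}"

end

theory Submission
  imports Defs
begin

text \<open>Suppose D line-crosses L, the two lines meeting D first in a, a' and L last in b, b'. Then
  a, b, a', b' are in convex position in this cyclic order, and the chord from b to b' is the whole
  intersection of its line with the region to the left of both lines. As this chord lies in L, its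
  line separates a from a' within D - L; likewise for L - D.

  Strictness of the relations is witnessed by pairs of congruent polygons sharing boundary
  vertices: a common supporting line through a shared vertex is not a crossing line. If the
  vertices on the hull of the union are in cyclic order d, l, c, d, l, c with each c shared, then
  D line-crosses L but not conversely; in the cyclic order d, c, l, c, d, c, l, c there are no
  crossing lines, yet both differences are disconnected.\<close>

section \<open>Cross products and the normal form of a crossing line\<close>

definition cross2 :: "point \<Rightarrow> point \<Rightarrow> real" where
  "cross2 v w = v $ 1 * w $ 2 - v $ 2 * w $ 1"

lemma point_eq_iff: "v = w \<longleftrightarrow> v $ 1 = w $ 1 \<and> v $ 2 = w $ 2" for v w :: point
  by (simp add: vec_eq_iff forall_2)

text \<open>Measured from its first point by a unit direction, the order on \<open>t\<close> becomes
  the order of the parameter \<open>s\<close>. As \<open>a\<close> is in \<open>D - L\<close> and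
  \<open>b\<close> in \<open>L - D\<close>, they differ, so \<open>\<beta>\<close> is
  positive.\<close>

lemma crossing_lineE:
  assumes "crossing_line D L t"
  obtains a b \<beta> where
    "a \<in> D - L" "b \<in> L - D" "norm (snd t) = 1"
    "fst t = {a + s *\<^sub>R snd t | s. True}"
    "b = a + \<beta> *\<^sub>R snd t" "\<beta> > 0"
    "\<And>x. x \<in> D \<union> L \<Longrightarrow> 0 \<le> cross2 (snd t) (x - a)"
    "\<And>s. a + s *\<^sub>R snd t \<in> D \<union> L \<Longrightarrow> 0 \<le> s \<and> s \<le> \<beta>"
proof -
  obtain a b where a: "is_first_point t ((D \<union> L) \<inter> fst t) a" "a \<in> D - L"
    and b: "is_last_point t ((D \<union> L) \<inter> fst t) b" "b \<in> L - D"
    and sup: "supporting_line t D" "supporting_line t L"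
    using assms unfolding crossing_line_def by blast
  obtain p where n: "norm (snd t) = 1" and p: "fst t = {p + s *\<^sub>R snd t | s. True}"
    using sup unfolding supporting_line_def directed_line_def by blast
  have at: "a \<in> fst t" and bt: "b \<in> fst t"
    using a b by (auto simp: is_first_point_def is_last_point_def)
  obtain s0 where s0: "a = p + s0 *\<^sub>R snd t" using at p by auto
  have line: "fst t = {a + s *\<^sub>R snd t | s. True}"
  proof -
    have "p + s *\<^sub>R snd t = a + (s - s0) *\<^sub>R snd t" "a + s *\<^sub>R snd t = p + (s + s0) *\<^sub>R snd t" for s
      using s0 by (auto simp: algebra_simps)
    then show ?thesis unfolding p by blast
  qed
  obtain \<beta> where \<beta>: "b = a + \<beta> *\<^sub>R snd t" using bt line by auto
  have uu: "snd t \<bullet> snd t = 1" using n by (simp add: dot_square_norm)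
  have range: "0 \<le> s \<and> s \<le> \<beta>" if "a + s *\<^sub>R snd t \<in> D \<union> L" for s
  proof -
    have "a + s *\<^sub>R snd t \<in> (D \<union> L) \<inter> fst t" using that line by blast
    then have "a \<bullet> snd t \<le> (a + s *\<^sub>R snd t) \<bullet> snd t" "(a + s *\<^sub>R snd t) \<bullet> snd t \<le> b \<bullet> snd t"
      using a b unfolding is_first_point_def is_last_point_def by blast+
    then show ?thesis unfolding \<beta> by (simp add: inner_add_left uu)
  qed
  have "0 \<le> \<beta>" using range[of \<beta>] b \<beta> by auto
  moreover have "\<beta> \<noteq> 0" using \<beta> a b by auto
  ultimately have "\<beta> > 0" by simp
  moreover have "0 \<le> cross2 (snd t) (x - a)" if "x \<in> D \<union> L" for x
    using that sup at unfolding supporting_line_def left_half_plane_def cross2_def by blast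
  ultimately show ?thesis using that[OF a(2) b(2) n line \<beta>] range by blast
qed

section \<open>Line-crossing implies Fejes-Toth-crossing\<close>

lemma not_path_connected_separated:
  fixes g :: "point \<Rightarrow> real"
  assumes "continuous_on UNIV g" "x \<in> S" "g x < 0" "y \<in> S" "0 < g y" "\<And>z. z \<in> S \<Longrightarrow> g z \<noteq> 0"
  shows "\<not> path_connected S"
proof
  assume "path_connected S"
  then have "connected (g ` S)"
    by (intro connected_continuous_image path_connected_imp_connected
        continuous_on_subset[OF assms(1)]) auto
  moreover have "g x \<in> g ` S" "g y \<in> g ` S" using assms by auto
  ultimately have "0 \<in> g ` S"
    using assms(3,5) unfolding connected_iff_interval by (meson less_imp_le)
  then show False using assms(6) by auto
qed

lemma continuous_on_cross2: "continuous_on UNIV (\<lambda>x. cross2 v (x - p))"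
  unfolding cross2_def by (intro continuous_intros)

lemma cross2_zero_imp_parallel:
  assumes "u \<noteq> 0" "cross2 u w = 0"
  obtains s where "w = s *\<^sub>R u"
proof -
  define n c where "n = u $ 1 * u $ 1 + u $ 2 * u $ 2" and "c = w $ 1 * u $ 1 + w $ 2 * u $ 2"
  have n: "n \<noteq> 0"
    using assms(1) unfolding n_def point_eq_iff by (simp add: sum_squares_eq_zero_iff)
  have "n * w $ 1 = c * u $ 1" "n * w $ 2 = c * u $ 2"
    using assms(2) unfolding cross2_def n_def c_def by algebra+
  then have "w = (c / n) *\<^sub>R u" using n by (simp add: point_eq_iff field_simps)
  then show ?thesis using that by blast
qed

text \<open>A point \<open>b + s *\<^sub>R (b' - b)\<close> of \<open>D\<close> has
  \<open>s \<ge> 0\<close> by the half-plane of \<open>u\<close> and \<open>s \<le> 1\<close> by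
  that of \<open>v\<close>, so it is on the chord and in \<open>L\<close>. Hence the line misses
  \<open>D - L\<close>, with \<open>x\<close> and \<open>y\<close> on its two sides.\<close>

lemma chord_separates:
  assumes "convex L" "b \<in> L" "b' \<in> L" "x \<in> D - L" "y \<in> D - L"
    and neg: "cross2 (b' - b) (x - b) < 0" and pos: "0 < cross2 (b' - b) (y - b)"
    and u: "cross2 u (b - p) = 0" "0 < cross2 u (b' - p)" "\<And>z. z \<in> D \<Longrightarrow> 0 \<le> cross2 u (z - p)"
    and v: "cross2 v (b' - q) = 0" "0 < cross2 v (b - q)" "\<And>z. z \<in> D \<Longrightarrow> 0 \<le> cross2 v (z - q)"
  shows "\<not> path_connected (D - L)"
proof (rule not_path_connected_separated[OF continuous_on_cross2 assms(4) neg assms(5) pos])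
  fix z assume z: "z \<in> D - L"
  show "cross2 (b' - b) (z - b) \<noteq> 0"
  proof
    assume 0: "cross2 (b' - b) (z - b) = 0"
    have "b' - b \<noteq> 0" using pos by (auto simp: cross2_def)
    then obtain s where "z - b = s *\<^sub>R (b' - b)" using 0 cross2_zero_imp_parallel by blast
    then have s: "z = b + s *\<^sub>R (b' - b)" by (simp add: algebra_simps)
    have "cross2 u (z - p) = (1 - s) * cross2 u (b - p) + s * cross2 u (b' - p)"
      "cross2 v (z - q) = (1 - s) * cross2 v (b - q) + s * cross2 v (b' - q)"
      unfolding s cross2_def by (simp_all add: algebra_simps)
    then have "0 \<le> s * cross2 u (b' - p)" "0 \<le> (1 - s) * cross2 v (b - q)"
      using u(1) u(3)[of z] v(1) v(3)[of z] z by auto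
    then have "0 \<le> s" "s \<le> 1" using u(2) v(2) by (auto simp: zero_le_mult_iff)
    moreover have "z = (1 - s) *\<^sub>R b + s *\<^sub>R b'" unfolding s by (simp add: algebra_simps)
    ultimately have "z \<in> L" using assms(1,2,3) by (simp add: convexD)
    then show False using z by simp
  qed
qed

text \<open>By \<open>turn\<close>, the second direction is a left turn of the first by at most a
  half turn. Distance from \<open>t\<close> then does not decrease along \<open>t'\<close>, nor
  distance from \<open>t'\<close> increase along \<open>t\<close>; so it suffices that
  \<open>a'\<close> is off \<open>t\<close> and \<open>b\<close> is off \<open>t'\<close>.\<close>

lemma crossing_lines_imp_fejes_toth:
  assumes DL: "convex D" "convex L"
    and t: "crossing_line D L t" and t': "crossing_line D L t'" and "t \<noteq> t'"
    and turn: "0 \<le> cross2 (snd t) (snd t')"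
  shows "fejes_toth_crossing D L"
proof -
  define u v where "u = snd t" and "v = snd t'"
  obtain a b \<beta> where a: "a \<in> D - L" and b: "b \<in> L - D" and u1: "norm u = 1"
    and line: "fst t = {a + s *\<^sub>R u | s. True}" and b_eq: "b = a + \<beta> *\<^sub>R u" and \<beta>: "\<beta> > 0"
    and left: "\<And>x. x \<in> D \<union> L \<Longrightarrow> 0 \<le> cross2 u (x - a)"
    and range: "\<And>s. a + s *\<^sub>R u \<in> D \<union> L \<Longrightarrow> 0 \<le> s \<and> s \<le> \<beta>"
    by (rule crossing_lineE[OF t, folded u_def]) (rule that)
  obtain a' b' \<beta>' where a': "a' \<in> D - L" and b': "b' \<in> L - D" and v1: "norm v = 1"
    and line': "fst t' = {a' + s *\<^sub>R v | s. True}" and b'_eq: "b' = a' + \<beta>' *\<^sub>R v" and \<beta>': "\<beta>' > 0"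
    and left': "\<And>x. x \<in> D \<union> L \<Longrightarrow> 0 \<le> cross2 v (x - a')"
    and range': "\<And>s. a' + s *\<^sub>R v \<in> D \<union> L \<Longrightarrow> 0 \<le> s \<and> s \<le> \<beta>'"
    by (rule crossing_lineE[OF t', folded v_def]) (rule that)
  have u0: "u \<noteq> 0" and v0: "v \<noteq> 0" using u1 v1 by auto
  have ne: "a' \<noteq> b" using a' b by auto
  define \<sigma> where "\<sigma> = cross2 u v"
  have cross_b': "cross2 u (b' - a) = cross2 u (a' - a) + \<beta>' * \<sigma>"
    and cross_b: "cross2 v (a - a') = cross2 v (b - a') + \<beta> * \<sigma>"
    unfolding b_eq b'_eq cross2_def \<sigma>_def by (simp_all add: algebra_simps)
  have pos: "0 < cross2 u (a' - a) \<and> 0 < cross2 v (b - a')"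
  proof (cases "\<sigma> = 0")
    case False
    then have \<sigma>: "\<sigma> > 0" using turn by (simp add: \<sigma>_def u_def v_def)
    \<comment> \<open>If \<open>a'\<close> were on \<open>t\<close>, then
      \<open>s \<le> \<beta>\<close>, while \<open>b\<close> being left of \<open>t'\<close> forces
      \<open>s \<ge> \<beta>\<close>. So \<open>a' = b\<close>, which is impossible.\<close>
    have "cross2 u (a' - a) \<noteq> 0"
    proof
      assume "cross2 u (a' - a) = 0"
      then obtain s where "a' - a = s *\<^sub>R u" using cross2_zero_imp_parallel[OF u0] by blast
      then have s: "a' = a + s *\<^sub>R u" by (simp add: algebra_simps)
      then have "s \<le> \<beta>" using range[of s] a' by auto
      moreover have "cross2 v (b - a') = - ((\<beta> - s) * \<sigma>)"
        unfolding b_eq s cross2_def \<sigma>_def by (simp add: algebra_simps)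
      then have "(\<beta> - s) * \<sigma> \<le> 0" using left'[of b] b by auto
      ultimately have "s = \<beta>" using \<sigma> by (simp add: mult_le_0_iff)
      then show False using ne s b_eq by simp
    qed
    moreover have "cross2 v (b - a') \<noteq> 0"
    proof
      assume "cross2 v (b - a') = 0"
      then obtain s where "b - a' = s *\<^sub>R v" using cross2_zero_imp_parallel[OF v0] by blast
      then have s: "b = a' + s *\<^sub>R v" by (simp add: algebra_simps)
      then have "0 \<le> s" using range'[of s] b by auto
      moreover have "cross2 u (a' - a) = - (s * \<sigma>) + cross2 u (b - a)"
        unfolding s cross2_def \<sigma>_def by (simp add: algebra_simps)
      moreover have "cross2 u (b - a) = 0" unfolding b_eq cross2_def by simp
      ultimately have "s * \<sigma> \<le> 0" using left[of a'] a' by auto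
      then have "s = 0" using \<sigma> \<open>0 \<le> s\<close> by (simp add: mult_le_0_iff)
      then show False using ne s by simp
    qed
    ultimately show ?thesis using left[of a'] left'[of b] a' b by force
  next
    case True
    then obtain k where k: "v = k *\<^sub>R u"
      using cross2_zero_imp_parallel[OF u0] unfolding \<sigma>_def by blast
    then have "k = 1 \<or> k = -1" using u1 v1 by (auto simp: abs_if split: if_splits)
    moreover have cv: "cross2 v (b - a') = - (k * cross2 u (a' - a))"
      unfolding k b_eq cross2_def by (simp add: algebra_simps)
    have "k \<noteq> 1"
    proof
      assume "k = 1"
      then have "v = u" using k by simp
      have "cross2 u (a' - a) = 0"
        using cv \<open>k = 1\<close> left[of a'] left'[of b] a' b by auto
      then obtain s0 where "a' - a = s0 *\<^sub>R u" using cross2_zero_imp_parallel[OF u0] by blast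
      then have "a' + s *\<^sub>R u = a + (s + s0) *\<^sub>R u" "a + s *\<^sub>R u = a' + (s - s0) *\<^sub>R u" for s
        by (auto simp: algebra_simps)
      then have "fst t = fst t'" unfolding line line' \<open>v = u\<close> by blast
      then show False using \<open>t \<noteq> t'\<close> \<open>v = u\<close> by (simp add: u_def v_def prod_eq_iff)
    qed
    ultimately have "k = -1" by simp
    \<comment> \<open>With opposite directions, a common underlying line gives
      \<open>s \<le> \<beta>\<close> from \<open>t\<close> and \<open>s \<ge> \<beta>\<close> from
      \<open>t'\<close>, so again \<open>a' = b\<close>.\<close>
    have "cross2 u (a' - a) \<noteq> 0"
    proof
      assume "cross2 u (a' - a) = 0"
      then obtain s where "a' - a = s *\<^sub>R u" using cross2_zero_imp_parallel[OF u0] by blast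
      then have s: "a' = a + s *\<^sub>R u" by (simp add: algebra_simps)
      then have "s \<le> \<beta>" using range[of s] a' by auto
      moreover have "b = a' + (s - \<beta>) *\<^sub>R v" unfolding k \<open>k = -1\<close> b_eq s by (simp add: algebra_simps)
      then have "s \<ge> \<beta>" using range'[of "s - \<beta>"] b by auto
      ultimately show False using ne s b_eq by simp
    qed
    then show ?thesis using cv \<open>k = -1\<close> left[of a'] a' by force
  qed
  have \<sigma>: "0 \<le> \<sigma>" using turn by (simp add: \<sigma>_def u_def v_def)
  have pos': "0 < cross2 u (b' - a)" "0 < cross2 v (a - a')"
    using pos \<sigma> \<beta> \<beta>' cross_b cross_b' by (auto intro: add_pos_nonneg)
  have on: "cross2 u (b - a) = 0" "cross2 v (b' - a') = 0" "cross2 u (a - a) = 0" "cross2 v (a' - a') = 0"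
    unfolding b_eq b'_eq cross2_def by simp_all
  \<comment> \<open>\<open>a'\<close> is strictly right and \<open>a\<close> strictly left of the
    chord from \<open>b\<close> to \<open>b'\<close>.\<close>
  have "cross2 (b' - b) (a' - b) = - (\<beta>' * cross2 v (b - a'))"
    "cross2 (b' - b) (a - b) = \<beta> * cross2 u (b' - a)"
    unfolding b_eq b'_eq cross2_def by (simp_all add: algebra_simps)
  then have "cross2 (b' - b) (a' - b) < 0" "0 < cross2 (b' - b) (a - b)"
    using pos pos' \<beta> \<beta>' by simp_all
  then have "\<not> path_connected (D - L)"
    using chord_separates[of L b b' a' D a u a v a'] DL a b a' b' left left' on pos pos' by auto
  moreover have "cross2 (a' - a) (b' - a) = \<beta>' * cross2 v (a - a')"
    "cross2 (a' - a) (b - a) = - (\<beta> * cross2 u (a' - a))"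
    unfolding b_eq b'_eq cross2_def by (simp_all add: algebra_simps)
  then have "0 < cross2 (a' - a) (b' - a)" "cross2 (a' - a) (b - a) < 0"
    using pos pos' \<beta> \<beta>' by simp_all
  then have "\<not> path_connected (L - D)"
    using chord_separates[of D a a' b L b' u a v a'] DL a b a' b' left left' on pos pos' by auto
  ultimately show ?thesis unfolding fejes_toth_crossing_def by blast
qed

text \<open>Exchanging the lines negates the cross product of their directions, so one order is a
  left turn.\<close>

lemma line_crosses_imp_fejes_toth:
  assumes "convex D" "convex L" "line_crosses D L"
  shows "fejes_toth_crossing D L"
proof -
  obtain t t' where t: "t \<noteq> t'" "crossing_line D L t" "crossing_line D L t'"
    using assms(3) unfolding line_crosses_def by blast
  have "cross2 (snd t) (snd t') = - cross2 (snd t') (snd t)" by (simp add: cross2_def)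
  then consider "0 \<le> cross2 (snd t) (snd t')" | "0 \<le> cross2 (snd t') (snd t)" by linarith
  then show ?thesis using crossing_lines_imp_fejes_toth assms(1,2) t by cases metis+
qed

lemma fejes_toth_crossing_sym: "fejes_toth_crossing X Y \<longleftrightarrow> fejes_toth_crossing Y X"
  unfolding fejes_toth_crossing_def by blast

section \<open>Exhibiting and refuting crossing lines\<close>

lemma cross2_line [simp]:
  "cross2 u (x - (a + s *\<^sub>R u)) = cross2 u (x - a)"
  unfolding cross2_def by (simp add: algebra_simps)

lemma crossing_lineI:
  assumes u: "norm u = 1" and a: "a \<in> D - L" and b: "a + \<beta> *\<^sub>R u \<in> L - D"
    and left: "\<And>x. x \<in> D \<union> L \<Longrightarrow> 0 \<le> cross2 u (x - a)"
    and range: "\<And>s. a + s *\<^sub>R u \<in> D \<union> L \<Longrightarrow> 0 \<le> s \<and> s \<le> \<beta>"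
  shows "crossing_line D L ({a + s *\<^sub>R u | s. True}, u)"
proof -
  let ?t = "({a + s *\<^sub>R u | s. True}, u)"
  have uu: "u \<bullet> u = 1" using u by (simp add: dot_square_norm)
  have on: "a + s *\<^sub>R u \<in> fst ?t" for s by auto
  have at: "a \<in> fst ?t" using on[of 0] by simp
  have "directed_line ?t" using u unfolding directed_line_def by auto
  moreover have "D \<union> L \<subseteq> left_half_plane ?t"
    using left unfolding left_half_plane_def cross2_def[symmetric] by auto
  ultimately have "supporting_line ?t D" "supporting_line ?t L"
    unfolding supporting_line_def using a b at on[of \<beta>] by blast+
  moreover have "is_first_point ?t ((D \<union> L) \<inter> fst ?t) a"
    "is_last_point ?t ((D \<union> L) \<inter> fst ?t) (a + \<beta> *\<^sub>R u)"
    unfolding is_first_point_def is_last_point_def using a b at range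
    by (auto simp: inner_add_left uu)
  ultimately show ?thesis unfolding crossing_line_def using a b by blast
qed

text \<open>For refutations: \<open>b - a\<close> is a positive multiple of the direction, so only
  inequalities between coordinates of \<open>a\<close>, \<open>b\<close> and test points
  \<open>x\<close> remain.\<close>

lemma crossing_line_chord:
  assumes "crossing_line D L t"
  obtains a b where "a \<in> D - L" "b \<in> L - D" "\<And>x. x \<in> D \<union> L \<Longrightarrow> 0 \<le> cross2 (b - a) (x - a)"
proof (rule crossing_lineE[OF assms])
  fix a b \<beta>
  assume "a \<in> D - L" "b \<in> L - D" and b: "b = a + \<beta> *\<^sub>R snd t" "\<beta> > 0"
    and left: "\<And>x. x \<in> D \<union> L \<Longrightarrow> 0 \<le> cross2 (snd t) (x - a)"
  moreover have "cross2 (b - a) w = \<beta> * cross2 (snd t) w" for w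
    unfolding b cross2_def by (simp add: algebra_simps)
  ultimately show thesis using that by simp
qed

section \<open>Centrally symmetric polygons and their rotations\<close>

definition slab :: "real \<Rightarrow> real \<Rightarrow> real \<Rightarrow> point set" where
  "slab p q r = {x. \<bar>p * x $ 1 + q * x $ 2\<bar> \<le> r}"

lemma closed_slab: "closed (slab p q r)"
  unfolding slab_def by (intro closed_Collect_le continuous_intros)

lemma convex_slab: "convex (slab p q r)"
proof (rule convexI)
  fix x y :: point and u v :: real
  assume xy: "x \<in> slab p q r" "y \<in> slab p q r" and uv: "0 \<le> u" "0 \<le> v" "u + v = 1"
  have "convex {- r..r}" by simp
  moreover have "p * x $ 1 + q * x $ 2 \<in> {- r..r}" "p * y $ 1 + q * y $ 2 \<in> {- r..r}"
    using xy unfolding slab_def by auto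
  ultimately have "u *\<^sub>R (p * x $ 1 + q * x $ 2) + v *\<^sub>R (p * y $ 1 + q * y $ 2) \<in> {- r..r}"
    using uv by (rule convexD)
  then show "u *\<^sub>R x + v *\<^sub>R y \<in> slab p q r" unfolding slab_def by (auto simp: algebra_simps)
qed

lemma bounded_slabs: "bounded (slab 1 0 r \<inter> slab 0 1 r)"
proof (rule boundedI)
  fix x assume "x \<in> slab 1 0 r \<inter> slab 0 1 r"
  then show "norm x \<le> 2 * r" using norm_le_l1_cart[of x] by (simp add: slab_def sum_2)
qed

lemma compact_convex_slabs:
  assumes "X = slab p1 q1 r1 \<inter> slab p2 q2 r2 \<inter> slab p3 q3 r3" "X \<subseteq> slab 1 0 r \<inter> slab 0 1 r" "X \<noteq> {}"
  shows "compact_convex X"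
  using assms bounded_subset[OF bounded_slabs assms(2)]
  unfolding compact_convex_def
  by (auto simp: compact_eq_bounded_closed intro!: closed_Int closed_slab convex_Int convex_slab)

definition rot :: "real \<Rightarrow> real \<Rightarrow> point \<Rightarrow> point" where
  "rot c s x = vector [c * x $ 1 - s * x $ 2, s * x $ 1 + c * x $ 2]"

lemma plane_rotation_rot:
  assumes "c * c + s * s = 1"
  shows "plane_rotation (rot c s)"
proof -
  define A :: "real^2^2" where "A = vector [vector [c, - s], vector [s, c]]"
  have A: "A $ 1 $ 1 = c" "A $ 1 $ 2 = - s" "A $ 2 $ 1 = s" "A $ 2 $ 2 = c"
    unfolding A_def by simp_all
  have "orthogonal_matrix A"
    unfolding orthogonal_matrix_def using assms
    by (simp add: vec_eq_iff forall_2 matrix_matrix_mult_def transpose_def mat_def sum_2 A algebra_simps)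
  moreover have "det A = 1" using assms by (simp add: det_2 A)
  moreover have "rot c s = (\<lambda>x. 0 + A *v (x - 0))"
    by (simp add: fun_eq_iff rot_def point_eq_iff matrix_vector_mult_def sum_2 A)
  ultimately show ?thesis unfolding plane_rotation_def rotation_matrix_def by blast
qed

text \<open>\<open>rot c (- s)\<close> inverts \<open>rot c s\<close>, so an image is identified by
  testing preimages against inequalities.\<close>

lemma rot_image_eq:
  assumes "c * c + s * s = 1" and "\<And>x. x \<in> Y \<longleftrightarrow> rot c (- s) x \<in> X"
  shows "Y = rot c s ` X"
proof -
  have "rot c s (rot c (- s) x) = (c * c + s * s) *\<^sub>R x" "rot c (- s) (rot c s x) = (c * c + s * s) *\<^sub>R x" for x
    by (auto simp: rot_def point_eq_iff algebra_simps)
  then have "rot c s (rot c (- s) x) = x" "rot c (- s) (rot c s x) = x" for x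
    using assms(1) by simp_all
  then show ?thesis using assms(2) by (metis (no_types, lifting) image_iff set_eqI)
qed

section \<open>Two rectangles that line-cross in one direction only\<close>

text \<open>Rectangles inscribed in the circle of radius 5 with common vertices (0, 5), (0, -5) and the
  further vertices (4, -3), (-4, 3) and (4, 3), (-4, -3), respectively.\<close>

definition rect :: "point set" where
  "rect = slab 2 1 5 \<inter> slab 1 (- 2) 10"

definition rect' :: "point set" where
  "rect' = slab 2 (- 1) 5 \<inter> slab 1 2 10"

lemma mem_rect: "x \<in> rect \<longleftrightarrow> \<bar>2 * x $ 1 + x $ 2\<bar> \<le> 5 \<and> \<bar>x $ 1 - 2 * x $ 2\<bar> \<le> 10"
  and mem_rect': "x \<in> rect' \<longleftrightarrow> \<bar>2 * x $ 1 - x $ 2\<bar> \<le> 5 \<and> \<bar>x $ 1 + 2 * x $ 2\<bar> \<le> 10"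
  by (simp_all add: rect_def rect'_def slab_def)

lemma compact_convex_rects: "compact_convex rect" "compact_convex rect'"
proof -
  have "0 \<in> rect" "0 \<in> rect'" by (simp_all add: mem_rect mem_rect')
  moreover have "rect \<subseteq> slab 1 0 5 \<inter> slab 0 1 5" "rect' \<subseteq> slab 1 0 5 \<inter> slab 0 1 5"
    by (auto simp: mem_rect mem_rect' slab_def abs_le_iff)
  ultimately show "compact_convex rect" "compact_convex rect'"
    using compact_convex_slabs[of rect 2 1 5 1 "- 2" 10 1 "- 2" 10 5]
      compact_convex_slabs[of rect' 2 "- 1" 5 1 2 10 1 2 10 5]
    by (auto simp: rect_def rect'_def)
qed

text \<open>Cosine 3/5 and sine -4/5 take the vertices (0, 5) and (4, -3) of \<open>rect\<close> to
  (4, 3) and (0, -5). Both ordered pairs serve as witnesses, hence both directions.\<close>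

lemma rot_rects: "rect' = rot (3/5) (- 4/5) ` rect" "rect = rot (3/5) (4/5) ` rect'"
proof -
  show "rect' = rot (3/5) (- 4/5) ` rect"
    by (rule rot_image_eq) (simp_all add: mem_rect mem_rect' rot_def abs_le_iff, argo)
  show "rect = rot (3/5) (4/5) ` rect'"
    by (rule rot_image_eq) (simp_all add: mem_rect mem_rect' rot_def abs_le_iff, argo)
qed

lemma rect_line_crosses: "line_crosses rect rect'"
proof -
  let ?u = "vector [0, 1] :: point" and ?v = "vector [0, - 1] :: point"
  have n: "norm ?u = 1" "norm ?v = 1" by (simp_all add: norm_eq_1 inner_vec_def sum_2)
  \<comment> \<open>The hull edge from (4, -3) up to (4, 3), of length 6; the second line is its
    image under central symmetry.\<close>
  have "crossing_line rect rect' ({vector [4, - 3] + s *\<^sub>R ?u | s. True}, ?u)"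
    by (rule crossing_lineI[where \<beta> = 6])
      (auto simp: n mem_rect mem_rect' cross2_def abs_le_iff)
  moreover have "crossing_line rect rect' ({vector [- 4, 3] + s *\<^sub>R ?v | s. True}, ?v)"
    by (rule crossing_lineI[where \<beta> = 6])
      (auto simp: n mem_rect mem_rect' cross2_def abs_le_iff)
  moreover have "?u \<noteq> ?v" by (simp add: point_eq_iff)
  ultimately show ?thesis unfolding line_crosses_def by blast
qed

text \<open>A point of \<open>rect\<close> without strictly opposite coordinate signs satisfies
  2|x1| + |x2| <= 5 and so lies in \<open>rect'\<close>. For opposite signs, |x1| + 2|x2| <= 10
  gives |x2| < 5.\<close>

lemma rect_diff:
  assumes "x \<in> rect - rect'"
  shows "\<bar>x $ 2\<bar> < 5" "x $ 1 > 0 \<and> x $ 2 < 0 \<or> x $ 1 < 0 \<and> x $ 2 > 0"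
  using assms by (auto simp: mem_rect mem_rect' abs_le_iff abs_less_iff)

lemma rect'_diff:
  assumes "x \<in> rect' - rect"
  shows "\<bar>x $ 2\<bar> < 5" "x $ 1 > 0 \<and> x $ 2 > 0 \<or> x $ 1 < 0 \<and> x $ 2 < 0"
  using assms by (auto simp: mem_rect mem_rect' abs_le_iff abs_less_iff)

text \<open>Not even one such line exists, as a test point is strictly right of the chord from
  \<open>a\<close> to \<open>b\<close>: the centre if both ends are on one side of the vertical
  axis, (0, 5) if the chord runs from right to left, (0, -5) if from left to right.\<close>

lemma not_rect'_line_crosses: "\<not> line_crosses rect' rect"
proof
  assume "line_crosses rect' rect"
  then obtain t where "crossing_line rect' rect t" unfolding line_crosses_def by blast
  then obtain a b where a: "a \<in> rect' - rect" and b: "b \<in> rect - rect'"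
    and left: "\<And>x. x \<in> rect' \<union> rect \<Longrightarrow> 0 \<le> cross2 (b - a) (x - a)"
    by (rule crossing_line_chord) (rule that)
  have "0 \<le> cross2 (b - a) (0 - a)" "0 \<le> cross2 (b - a) (vector [0, 5] - a)"
    "0 \<le> cross2 (b - a) (vector [0, - 5] - a)"
    using left[of 0] left[of "vector [0, 5]"] left[of "vector [0, - 5]"]
    by (simp_all add: mem_rect mem_rect')
  then have 1: "b $ 1 * a $ 2 \<le> b $ 2 * a $ 1" and 2: "a $ 1 * (5 - b $ 2) \<le> b $ 1 * (5 - a $ 2)"
    and 3: "b $ 1 * (5 + a $ 2) \<le> a $ 1 * (5 + b $ 2)"
    by (simp_all add: cross2_def algebra_simps)
  have h: "0 < 5 - b $ 2" "0 < 5 - a $ 2" "0 < 5 + b $ 2" "0 < 5 + a $ 2"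
    using rect'_diff(1)[OF a] rect_diff(1)[OF b] by auto
  from rect'_diff(2)[OF a] rect_diff(2)[OF b]
  consider "a $ 1 > 0" "a $ 2 > 0" "b $ 1 > 0" "b $ 2 < 0" | "a $ 1 < 0" "a $ 2 < 0" "b $ 1 < 0" "b $ 2 > 0"
    | "a $ 1 > 0" "b $ 1 < 0" | "a $ 1 < 0" "b $ 1 > 0" by blast
  then show False
  proof cases
    assume "a $ 1 > 0" "a $ 2 > 0" "b $ 1 > 0" "b $ 2 < 0"
    then show False using 1 mult_pos_pos[of "b $ 1" "a $ 2"] mult_neg_pos[of "b $ 2" "a $ 1"] by linarith
  next
    assume "a $ 1 < 0" "a $ 2 < 0" "b $ 1 < 0" "b $ 2 > 0"
    then show False using 1 mult_neg_neg[of "b $ 1" "a $ 2"] mult_pos_neg[of "b $ 2" "a $ 1"] by linarith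
  next
    assume "a $ 1 > 0" "b $ 1 < 0"
    then show False using 2 h mult_pos_pos[of "a $ 1" "5 - b $ 2"] mult_neg_pos[of "b $ 1" "5 - a $ 2"] by linarith
  next
    assume "a $ 1 < 0" "b $ 1 > 0"
    then show False using 3 h mult_pos_pos[of "b $ 1" "5 + a $ 2"] mult_neg_pos[of "a $ 1" "5 + b $ 2"] by linarith
  qed
qed

section \<open>Two Fejes-Toth-crossing hexagons without crossing lines\<close>

text \<open>Hexagons with four common vertices, the points with both coordinates 2 or -2, and the further
  vertices (3, 0), (-3, 0) and (0, 3), (0, -3), respectively.\<close>

definition hexagon :: "point set" where
  "hexagon = slab 0 1 2 \<inter> slab 2 1 6 \<inter> slab 2 (- 1) 6"

definition hexagon' :: "point set" where
  "hexagon' = slab 1 0 2 \<inter> slab 1 2 6 \<inter> slab 1 (- 2) 6"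

lemma mem_hexagon: "x \<in> hexagon \<longleftrightarrow> \<bar>x $ 2\<bar> \<le> 2 \<and> \<bar>2 * x $ 1 + x $ 2\<bar> \<le> 6 \<and> \<bar>2 * x $ 1 - x $ 2\<bar> \<le> 6"
  and mem_hexagon': "x \<in> hexagon' \<longleftrightarrow> \<bar>x $ 1\<bar> \<le> 2 \<and> \<bar>x $ 1 + 2 * x $ 2\<bar> \<le> 6 \<and> \<bar>x $ 1 - 2 * x $ 2\<bar> \<le> 6"
  by (simp_all add: hexagon_def hexagon'_def slab_def)

lemma compact_convex_hexagons: "compact_convex hexagon" "compact_convex hexagon'"
proof -
  have "0 \<in> hexagon" "0 \<in> hexagon'" by (simp_all add: mem_hexagon mem_hexagon')
  moreover have "hexagon \<subseteq> slab 1 0 3 \<inter> slab 0 1 3" "hexagon' \<subseteq> slab 1 0 3 \<inter> slab 0 1 3"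
    by (auto simp: mem_hexagon mem_hexagon' slab_def abs_le_iff)
  ultimately show "compact_convex hexagon" "compact_convex hexagon'"
    by (auto intro: compact_convex_slabs[OF hexagon_def] compact_convex_slabs[OF hexagon'_def])
qed

lemma rot_hexagon: "hexagon' = rot 0 1 ` hexagon"
  by (rule rot_image_eq) (simp_all add: mem_hexagon mem_hexagon' rot_def abs_le_iff, argo)

text \<open>A point of \<open>hexagon\<close> with |x1| <= 2 has |x1| + 2|x2| <= 6 and lies in
  \<open>hexagon'\<close>, so only the two tips remain. The last bound rewrites the slanted edges
  2|x1| + |x2| <= 6.\<close>

lemma hexagon_diff:
  assumes "x \<in> hexagon - hexagon'"
  shows "\<bar>x $ 1\<bar> > 2" "\<bar>x $ 2\<bar> \<le> 2" "2 * (\<bar>x $ 1\<bar> - 2) \<le> 2 - \<bar>x $ 2\<bar>"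
  using assms by (auto simp: mem_hexagon mem_hexagon' abs_if split: if_splits)

lemma hexagon'_diff:
  assumes "x \<in> hexagon' - hexagon"
  shows "\<bar>x $ 2\<bar> > 2" "\<bar>x $ 1\<bar> \<le> 2" "2 * (\<bar>x $ 2\<bar> - 2) \<le> 2 - \<bar>x $ 1\<bar>"
  using assms by (auto simp: mem_hexagon mem_hexagon' abs_if split: if_splits)

lemma hexagon_fejes_toth: "fejes_toth_crossing hexagon hexagon'"
proof -
  have "\<not> path_connected (hexagon - hexagon')"
  proof (rule not_path_connected_separated[where g = "\<lambda>x. x $ 1"])
    show "vector [- 3, 0] \<in> hexagon - hexagon'" "vector [3, 0] \<in> hexagon - hexagon'"
      by (simp_all add: mem_hexagon mem_hexagon')
  qed (use hexagon_diff(1) in \<open>force intro!: continuous_intros\<close>)+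
  moreover have "\<not> path_connected (hexagon' - hexagon)"
  proof (rule not_path_connected_separated[where g = "\<lambda>x. x $ 2"])
    show "vector [0, - 3] \<in> hexagon' - hexagon" "vector [0, 3] \<in> hexagon' - hexagon"
      by (simp_all add: mem_hexagon mem_hexagon')
  qed (use hexagon'_diff(1) in \<open>force intro!: continuous_intros\<close>)+
  ultimately show ?thesis unfolding fejes_toth_crossing_def by blast
qed

lemma corner_product_less:
  fixes p q P Q :: real
  assumes "0 < p" "0 < q" "2 * p \<le> P" "2 * q \<le> Q"
  shows "p * q < P * Q"
proof -
  have "p * q < (2 * p) * (2 * q)" using assms by simp
  also have "\<dots> \<le> P * Q" using assms by (intro mult_mono) auto
  finally show ?thesis .
qed

text \<open>The centre and a common vertex lie on different sides of the line through a and b, which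
  therefore supports neither hexagon, in either orientation.\<close>

lemma hexagon_chord:
  assumes a: "a \<in> hexagon - hexagon'" and b: "b \<in> hexagon' - hexagon"
  obtains c where "c \<in> hexagon \<inter> hexagon'"
    "cross2 (b - a) (0 - a) > 0 \<and> cross2 (b - a) (c - a) < 0 \<or>
     cross2 (b - a) (0 - a) < 0 \<and> cross2 (b - a) (c - a) > 0"
proof -
  note A = hexagon_diff[OF a] and B = hexagon'_diff[OF b]
  \<comment> \<open>These signs reduce all cases to \<open>a\<close> in the right tip and
    \<open>b\<close> in the top tip; \<open>c\<close> is the common vertex between these
    tips.\<close>
  define \<sigma> \<tau> where "\<sigma> = sgn (a $ 1)" and "\<tau> = sgn (b $ 2)"
  have \<sigma>: "\<sigma> = 1 \<or> \<sigma> = - 1" "\<sigma> * a $ 1 > 2" "2 * (\<sigma> * a $ 1 - 2) \<le> 2 - \<bar>a $ 2\<bar>"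
    and \<tau>: "\<tau> = 1 \<or> \<tau> = - 1" "\<tau> * b $ 2 > 2" "2 * (\<tau> * b $ 2 - 2) \<le> 2 - \<bar>b $ 1\<bar>"
    using A B by (auto simp: \<sigma>_def \<tau>_def sgn_if)
  define c :: point where "c = vector [2 * \<sigma>, 2 * \<tau>]"
  have c: "c \<in> hexagon \<inter> hexagon'"
    using \<sigma>(1) \<tau>(1) by (auto simp: c_def mem_hexagon mem_hexagon')
  have lt: "\<bar>a $ 2\<bar> < \<sigma> * a $ 1" "\<bar>b $ 1\<bar> < \<tau> * b $ 2" using \<sigma> \<tau> A B by linarith+
  have "\<bar>a $ 2 * b $ 1\<bar> < (\<sigma> * a $ 1) * (\<tau> * b $ 2)"
    unfolding abs_mult using lt by (intro mult_strict_mono) auto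
  then have 0: "0 < \<sigma> * \<tau> * cross2 (b - a) (0 - a)"
    using \<sigma>(1) \<tau>(1) by (auto simp: cross2_def algebra_simps abs_less_iff)
  \<comment> \<open>The left side minus the right side is
    \<open>\<sigma> * \<tau> * cross2 (b - a) (c - a)\<close>. The slope of the slanted edges
    supplies the factors 2 in \<open>corner_product_less\<close>.\<close>
  have "(\<sigma> * a $ 1 - 2) * (\<tau> * b $ 2 - 2) < (2 - \<tau> * a $ 2) * (2 - \<sigma> * b $ 1)"
    using \<sigma> \<tau> by (intro corner_product_less) auto
  then have "\<sigma> * \<tau> * cross2 (b - a) (c - a) < 0"
    using \<sigma>(1) \<tau>(1) by (auto simp: cross2_def c_def algebra_simps)
  with 0 c show thesis using that \<sigma>(1) \<tau>(1) by auto
qed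

lemma not_hexagon_weakly_line_cross: "\<not> weakly_line_cross hexagon hexagon'"
proof
  assume "weakly_line_cross hexagon hexagon'"
  then consider t where "crossing_line hexagon hexagon' t" | t where "crossing_line hexagon' hexagon t"
    unfolding weakly_line_cross_def line_crosses_def by blast
  then show False
  proof cases
    case 1
    then obtain a b where a: "a \<in> hexagon - hexagon'" and b: "b \<in> hexagon' - hexagon"
      and left: "\<And>x. x \<in> hexagon \<union> hexagon' \<Longrightarrow> 0 \<le> cross2 (b - a) (x - a)"
      by (rule crossing_line_chord) (rule that)
    obtain c where "c \<in> hexagon" "cross2 (b - a) (0 - a) < 0 \<or> cross2 (b - a) (c - a) < 0"
      using hexagon_chord[OF a b] by blast
    moreover have "(0::point) \<in> hexagon" by (simp add: mem_hexagon)
    ultimately show False using left[of 0] left[of c] by auto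
  next
    case 2
    then obtain b a where b: "b \<in> hexagon' - hexagon" and a: "a \<in> hexagon - hexagon'"
      and left: "\<And>x. x \<in> hexagon' \<union> hexagon \<Longrightarrow> 0 \<le> cross2 (a - b) (x - b)"
      by (rule crossing_line_chord) (rule that)
    \<comment> \<open>Reversing the chord lets \<open>hexagon_chord\<close> refute this case through
      the opposite signs.\<close>
    have "cross2 (b - a) (x - a) = - cross2 (a - b) (x - b)" for x
      by (simp add: cross2_def algebra_simps)
    then have right: "cross2 (b - a) (x - a) \<le> 0" if "x \<in> hexagon' \<union> hexagon" for x
      using left[OF that] by simp
    obtain c where "c \<in> hexagon" "cross2 (b - a) (0 - a) > 0 \<or> cross2 (b - a) (c - a) > 0"
      using hexagon_chord[OF a b] by blast
    moreover have "(0::point) \<in> hexagon" by (simp add: mem_hexagon)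
    ultimately show False using right[of 0] right[of c] by auto
  qed
qed

section \<open>The order on the five concepts and its covering relation\<close>

text \<open>Common form of both orders: \<open>S\<close> holds all pairs of compact convex sets, or
  only those whose second set is a rotated copy of the first.\<close>

definition pair_le :: "(point set \<times> point set) set \<Rightarrow> concept rel" where
  "pair_le S = {(u, v). u \<in> HCC \<and> v \<in> HCC \<and> u \<inter> S \<subseteq> v}"

lemma HCC_le_eq: "HCC_le = pair_le {(D, L). compact_convex D \<and> compact_convex L}"
  unfolding HCC_le_def pair_le_def by auto

lemma HCC_le_rot_eq: "HCC_le_rot = pair_le {(D, L). compact_convex D \<and> compact_convex L \<and>
    (\<exists>f. plane_rotation f \<and> L = f ` D)}"
  unfolding HCC_le_rot_def pair_le_def by auto

lemmas concept_defs =
  concept_of_def cc_beta_def cc_lambda_def cc_rho_def cc_epsilon_def cc_tau_def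
  strongly_line_cross_def weakly_line_cross_def

lemma concept_inclusions:
  "cc_beta \<subseteq> cc_lambda" "cc_beta \<subseteq> cc_rho" "cc_lambda \<subseteq> cc_epsilon" "cc_rho \<subseteq> cc_epsilon"
  "cc_epsilon \<subseteq> cc_tau"
proof -
  show "cc_epsilon \<subseteq> cc_tau"
    using line_crosses_imp_fejes_toth fejes_toth_crossing_sym
    unfolding concept_defs compact_convex_def by fast
qed (auto simp: concept_defs)

lemma concept_separations:
  "(rect, rect') \<in> cc_lambda - cc_rho" "(rect', rect) \<in> cc_rho - cc_lambda"
  "(hexagon, hexagon') \<in> cc_tau - cc_epsilon"
  using compact_convex_rects compact_convex_hexagons rect_line_crosses not_rect'_line_crosses
    hexagon_fejes_toth not_hexagon_weakly_line_cross
  by (auto simp: cc_lambda_def cc_rho_def cc_tau_def cc_epsilon_def concept_of_def)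

lemma concepts_distinct: "distinct [cc_beta, cc_lambda, cc_rho, cc_epsilon, cc_tau]"
  using concept_inclusions concept_separations by auto

lemma concepts_neq:
  "cc_beta \<noteq> cc_lambda" "cc_beta \<noteq> cc_rho" "cc_beta \<noteq> cc_epsilon" "cc_beta \<noteq> cc_tau"
  "cc_lambda \<noteq> cc_rho" "cc_lambda \<noteq> cc_epsilon" "cc_lambda \<noteq> cc_tau"
  "cc_rho \<noteq> cc_epsilon" "cc_rho \<noteq> cc_tau" "cc_epsilon \<noteq> cc_tau"
  using concepts_distinct by simp_all

definition concept_order :: "concept rel" where
  "concept_order = {(u, v). u \<in> HCC \<and> v \<in> HCC \<and>
     (u = v \<or> u = cc_beta \<or> v = cc_tau \<or> u \<noteq> cc_tau \<and> v = cc_epsilon)}"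

lemma concept_order_iff:
  "(u, v) \<in> concept_order \<longleftrightarrow> u \<in> HCC \<and> v \<in> HCC \<and>
     (u = v \<or> u = cc_beta \<or> v = cc_tau \<or> u \<noteq> cc_tau \<and> v = cc_epsilon)"
  by (simp add: concept_order_def)

text \<open>The inclusions hold on every \<open>S\<close>, and the three witness pairs refute all
  others. This is why restricting to rotated copies leaves the order unchanged.\<close>

lemma pair_le_eq_concept_order:
  assumes "{(rect, rect'), (rect', rect), (hexagon, hexagon')} \<subseteq> S"
  shows "pair_le S = concept_order"
proof -
  note incl = concept_inclusions
  have S: "(rect, rect') \<in> S" "(rect', rect) \<in> S" "(hexagon, hexagon') \<in> S" using assms by auto
  have mem: "(rect, rect') \<in> cc_lambda" "(rect, rect') \<in> cc_epsilon" "(rect, rect') \<in> cc_tau"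
    "(rect, rect') \<notin> cc_rho" "(rect, rect') \<notin> cc_beta"
    "(rect', rect) \<in> cc_rho" "(rect', rect) \<in> cc_epsilon" "(rect', rect) \<in> cc_tau"
    "(rect', rect) \<notin> cc_lambda" "(rect', rect) \<notin> cc_beta"
    "(hexagon, hexagon') \<in> cc_tau" "(hexagon, hexagon') \<notin> cc_epsilon"
    using incl concept_separations by (meson DiffD1 DiffD2 subsetD)+
  \<comment> \<open>These eleven failures and the nine inclusions in \<open>le\<close> exhaust the
    ordered pairs of distinct concepts.\<close>
  have sep: "\<not> cc_lambda \<inter> S \<subseteq> cc_beta" "\<not> cc_lambda \<inter> S \<subseteq> cc_rho" "\<not> cc_rho \<inter> S \<subseteq> cc_beta"
    "\<not> cc_rho \<inter> S \<subseteq> cc_lambda" "\<not> cc_epsilon \<inter> S \<subseteq> cc_beta" "\<not> cc_epsilon \<inter> S \<subseteq> cc_lambda"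
    "\<not> cc_epsilon \<inter> S \<subseteq> cc_rho" "\<not> cc_tau \<inter> S \<subseteq> cc_beta" "\<not> cc_tau \<inter> S \<subseteq> cc_lambda"
    "\<not> cc_tau \<inter> S \<subseteq> cc_rho" "\<not> cc_tau \<inter> S \<subseteq> cc_epsilon"
    using mem S by (meson IntI subsetD)+
  have le: "cc_beta \<inter> S \<subseteq> cc_lambda" "cc_beta \<inter> S \<subseteq> cc_rho" "cc_beta \<inter> S \<subseteq> cc_epsilon"
    "cc_beta \<inter> S \<subseteq> cc_tau" "cc_lambda \<inter> S \<subseteq> cc_epsilon" "cc_lambda \<inter> S \<subseteq> cc_tau"
    "cc_rho \<inter> S \<subseteq> cc_epsilon" "cc_rho \<inter> S \<subseteq> cc_tau" "cc_epsilon \<inter> S \<subseteq> cc_tau"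
    using incl by (meson Int_lower1 order_trans)+
  have "u \<inter> S \<subseteq> v \<longleftrightarrow> (u, v) \<in> concept_order" if "u \<in> HCC" "v \<in> HCC" for u v
    using that unfolding HCC_def
    by (elim insertE emptyE)
      (simp_all add: concept_order_iff HCC_def concepts_neq concepts_neq[symmetric] sep le)
  then have "(u, v) \<in> pair_le S \<longleftrightarrow> (u, v) \<in> concept_order" for u v
    by (cases "u \<in> HCC \<and> v \<in> HCC") (auto simp only: pair_le_def concept_order_iff mem_Collect_eq case_prod_conv)
  then show ?thesis by (intro equalityI subrelI) (simp_all only:)
qed

text \<open>Antisymmetry holds because intersecting with \<open>S\<close> loses nothing of a concept
  contained in \<open>S\<close>. This serves \<open>HCC_le\<close>; \<open>HCC_le_rot\<close> is a
  partial order by being equal to it.\<close>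

lemma partial_order_on_pair_le:
  assumes "\<And>u. u \<in> HCC \<Longrightarrow> u \<subseteq> S"
  shows "partial_order_on HCC (pair_le S)"
  unfolding partial_order_on_def preorder_on_def
proof (intro conjI)
  show "antisym (pair_le S)"
  proof (rule antisymI)
    fix u v assume "(u, v) \<in> pair_le S" "(v, u) \<in> pair_le S"
    then show "u = v" using assms[of u] assms[of v] unfolding pair_le_def by blast
  qed
qed (auto simp: pair_le_def refl_on_def trans_def)

lemma covering_concept_order:
  "covering concept_order = {(cc_beta, cc_lambda), (cc_beta, cc_rho), (cc_lambda, cc_epsilon),
     (cc_rho, cc_epsilon), (cc_epsilon, cc_tau)}" (is "_ = ?E")
proof -
  \<comment> \<open>\<open>concept_order\<close> relates only members of \<open>HCC\<close>, so
    \<open>w\<close> ranges over five candidates and covering becomes a finite check.\<close>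
  have cov: "(u, v) \<in> covering concept_order \<longleftrightarrow> u \<in> HCC \<and> v \<in> HCC \<and> (u, v) \<in> concept_order \<and> u \<noteq> v \<and>
      \<not> (\<exists>w\<in>HCC. w \<noteq> u \<and> w \<noteq> v \<and> (u, w) \<in> concept_order \<and> (w, v) \<in> concept_order)" for u v
  proof -
    have "(u, w) \<in> concept_order \<Longrightarrow> u \<in> HCC \<and> w \<in> HCC" for u w
      by (simp add: concept_order_iff)
    then show ?thesis unfolding covering_def by blast
  qed
  have E: "(u, v) \<in> covering concept_order \<longleftrightarrow> (u, v) \<in> ?E" if "u \<in> HCC" "v \<in> HCC" for u v
    using that unfolding HCC_def
    by (elim insertE emptyE)
      (simp_all add: cov concept_order_iff HCC_def concepts_neq concepts_neq[symmetric])
  show ?thesis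
  proof (intro equalityI subrelI)
    fix u v assume "(u, v) \<in> covering concept_order"
    moreover have "u \<in> HCC" "v \<in> HCC" using calculation unfolding cov by blast+
    ultimately show "(u, v) \<in> ?E" using E by (simp only:)
  next
    fix u v assume "(u, v) \<in> ?E"
    moreover have "?E \<subseteq> HCC \<times> HCC" by (simp add: HCC_def)
    then have "u \<in> HCC" "v \<in> HCC" using calculation by blast+
    ultimately show "(u, v) \<in> covering concept_order" using E by (simp only:)
  qed
qed

theorem theorem2p4:
  shows "distinct [cc_beta, cc_lambda, cc_rho, cc_epsilon, cc_tau]
    \<and> partial_order_on HCC HCC_le
    \<and> partial_order_on HCC HCC_le_rot
    \<and> HCC_le = HCC_le_rot
    \<and> covering HCC_le = {(cc_beta, cc_lambda), (cc_beta, cc_rho), (cc_lambda, cc_epsilon),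
                          (cc_rho, cc_epsilon), (cc_epsilon, cc_tau)}
    \<and> (cc_lambda, cc_rho) \<notin> HCC_le \<and> (cc_rho, cc_lambda) \<notin> HCC_le"
proof -
  have "plane_rotation (rot (3/5) (- 4/5))" "plane_rotation (rot (3/5) (4/5))" "plane_rotation (rot 0 1)"
    by (simp_all add: plane_rotation_rot)
  then have "HCC_le_rot = concept_order"
    unfolding HCC_le_rot_eq
    using rot_rects rot_hexagon compact_convex_rects compact_convex_hexagons
    by (intro pair_le_eq_concept_order) blast
  moreover have "HCC_le = concept_order"
    unfolding HCC_le_eq using compact_convex_rects compact_convex_hexagons
    by (intro pair_le_eq_concept_order) blast
  moreover have "partial_order_on HCC HCC_le"
    unfolding HCC_le_eq
    by (rule partial_order_on_pair_le) (unfold HCC_def concept_defs, elim insertE emptyE, simp_all, blast+)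
  moreover have "(cc_lambda, cc_rho) \<notin> concept_order" "(cc_rho, cc_lambda) \<notin> concept_order"
    by (simp_all add: concept_order_iff concepts_neq concepts_neq[symmetric])
  moreover note covering_concept_order
  ultimately show ?thesis using concepts_distinct by simp
qed

end
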